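(* Let $t$ be an odd positive integer and $n$ a positive integer. For every odd positive divisor $k$ of $n$, there is exactly one representation of $n$ as the sum of a $k$-term arithmetic progression of integers with difference $t$, and there is exactly one representation of $n$ as the sum of a $(2n/k)$-term arithmetic progression of integers with difference $t$. Moreover, $\Phi_t(n) = 2 d_1(n)$.
   Context: For $k \in \mathbb{N}$, $t \in \mathbb{N}_0$, $a \in \mathbb{Z}$, let $s_{k,t}(a) = \sum_{i=0}^{k-1}(a+it)$. Define $\Phi_t(n) = |\{(k,a) \in \mathbb{N}\times\mathbb{Z} : s_{k,t}(a) = n\}|$, the number of representations of $n$ as the sum of a finite arithmetic progression of integers (of any positive length $k$, first term $a \in \mathbb{Z}$) with difference $t$. $d_1(n)$ denotes the number of odd positive divisors of $n$. *)

theory Defs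
  imports Main
begin

definition ap_sum :: "nat \<Rightarrow> nat \<Rightarrow> int \<Rightarrow> int" where
  "ap_sum k t a = (\<Sum>i<k. a + int i * int t)"

(* As card of an infinite set is 0, a positive value of Phi also says that the set is finite. *)
definition Phi :: "nat \<Rightarrow> nat \<Rightarrow> nat" where
  "Phi t n = card {(k :: nat, a :: int). 0 < k \<and> ap_sum k t a = int n}"

definition d1 :: "nat \<Rightarrow> nat" where
  "d1 n = card {d :: nat. 0 < d \<and> odd d \<and> d dvd n}"

end

theory Submission
  imports Defs
begin

text \<open>
  Doubling the sum gives \<open>2 n = k (2 a + (k - 1) t)\<close>. For odd \<open>t\<close> the second factor has the
  opposite parity of \<open>k\<close>, and conversely any factorization \<open>2 n = k m\<close> with factors of opposite
  parity determines \<open>a\<close>. The odd factor of such a factorization is an odd divisor of \<open>n\<close>, and it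
  can be either \<open>k\<close> or \<open>m\<close>, whence the factor two.
\<close>

lemma two_ap_sum: "2 * ap_sum k t a = int k * (2 * a + (int k - 1) * int t)"
  unfolding ap_sum_def by (induction k) (auto simp: algebra_simps)

text \<open>By \<open>two_ap_sum\<close>, the doubled sum is affine in the first term with slope
  \<open>2 * k\<close>, which is nonzero.\<close>

lemma ap_sum_inject:
  assumes "0 < k" and "ap_sum k t a = ap_sum k t b"
  shows "a = b"
proof -
  have "int k * (2 * a + (int k - 1) * int t) = int k * (2 * b + (int k - 1) * int t)"
    unfolding two_ap_sum[symmetric] assms(2) ..
  then show ?thesis using assms(1) by simp
qed

text \<open>This removes the first term from the question: only the length \<open>k\<close> and its
  cofactor \<open>m\<close> in \<open>2 * n\<close> remain. For \<open>k = 0\<close> both sides fail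
  because \<open>n\<close> is positive.\<close>

lemma ap_sum_length_iff:
  assumes "odd t" and "0 < n"
  shows "(\<exists>a. ap_sum k t a = int n) \<longleftrightarrow> (\<exists>m. 2 * n = k * m \<and> (odd k \<longleftrightarrow> even m))"
proof
  assume "\<exists>a. ap_sum k t a = int n"
  then obtain a where "ap_sum k t a = int n" ..
  then have eq: "2 * int n = int k * (2 * a + (int k - 1) * int t)"
    by (metis two_ap_sum)
  define c where "c = 2 * a + (int k - 1) * int t"
  \<comment> \<open>The cofactor is so far only an integer; its positivity allows passing to
    \<open>nat c\<close>.\<close>
  have "0 < int k * c" using eq assms(2) unfolding c_def by linarith
  then have "0 < c" by (simp add: zero_less_mult_iff)
  have "2 * int n = int (k * nat c)" using eq \<open>0 < c\<close> by (simp add: c_def)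
  then have "2 * n = k * nat c" by linarith
  moreover have "odd k \<longleftrightarrow> even (nat c)"
    using assms(1) \<open>0 < c\<close> by (simp add: c_def even_nat_iff)
  ultimately show "\<exists>m. 2 * n = k * m \<and> (odd k \<longleftrightarrow> even m)" by blast
next
  assume "\<exists>m. 2 * n = k * m \<and> (odd k \<longleftrightarrow> even m)"
  then obtain m where m: "2 * n = k * m" "odd k \<longleftrightarrow> even m" by blast
  \<comment> \<open>Since \<open>t\<close> is odd, \<open>(k - 1) * t\<close> has the parity of
    \<open>k - 1\<close>, hence that of \<open>m\<close>. Half of the difference is the required
    first term.\<close>
  have "even (int m - (int k - 1) * int t)" using m(2) assms(1) by simp
  then obtain a where a: "int m - (int k - 1) * int t = 2 * a" by (elim evenE)
  have "2 * ap_sum k t a = int k * int m"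
    unfolding two_ap_sum a[symmetric] by simp
  also have "\<dots> = 2 * int n" using arg_cong[OF m(1), of int] by simp
  finally show "\<exists>a. ap_sum k t a = int n" by auto
qed

text \<open>Exactly one of \<open>k\<close> and \<open>m\<close> is odd, and being coprime to 2 it
  divides \<open>n\<close>. The two sets correspond to \<open>k\<close> and to \<open>m\<close>
  being the odd one.\<close>

lemma opposite_parity_factors_iff:
  assumes "0 < (n :: nat)"
  shows "(\<exists>m. 2 * n = k * m \<and> (odd k \<longleftrightarrow> even m)) \<longleftrightarrow>
    k \<in> {d. odd d \<and> d dvd n} \<union> (\<lambda>d. 2 * n div d) ` {d. odd d \<and> d dvd n}"
    (is "?L \<longleftrightarrow> k \<in> ?A \<union> ?f ` ?A")
proof
  assume ?L
  then obtain m where m: "2 * n = k * m" "odd k \<longleftrightarrow> even m" by blast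
  have odd_dvd: "d dvd n" if "odd d" "d dvd 2 * n" for d
    using that by (simp add: coprime_dvd_mult_right_iff)
  show "k \<in> ?A \<union> ?f ` ?A"
  proof (cases "odd k")
    case True
    then show ?thesis using m odd_dvd by simp
  next
    case False
    then have "odd m" using m(2) by simp
    moreover have "m dvd n" using \<open>odd m\<close> m(1) odd_dvd by simp
    moreover have "k = 2 * n div m" using m(1) \<open>odd m\<close> by (auto simp: odd_pos)
    ultimately show ?thesis by blast
  qed
next
  assume "k \<in> ?A \<union> ?f ` ?A"
  then consider "odd k" "k dvd n" | d where "odd d" "d dvd n" "k = 2 * n div d" by blast
  then show ?L
  proof cases
    case 1
    then obtain e where "n = k * e" by blast
    then show ?thesis using 1 by (intro exI[of _ "2 * e"]) simp
  next
    case 2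
    then obtain e where "n = d * e" by blast
    \<comment> \<open>Here \<open>k = 2 * e\<close>, so the odd divisor \<open>d\<close> itself is
      the cofactor.\<close>
    then show ?thesis using 2 by (intro exI[of _ d]) (auto simp: odd_pos)
  qed
qed

theorem theorem4:
  fixes t n :: nat
  assumes "odd t" and "0 < t" and "0 < n"
  shows "(\<forall>k :: nat. 0 < k \<and> odd k \<and> k dvd n \<longrightarrow>
            (\<exists>!a :: int. ap_sum k t a = int n) \<and>
            (\<exists>!a :: int. ap_sum (2 * n div k) t a = int n))
         \<and> Phi t n = 2 * d1 n"
proof -
  define A where "A = {d :: nat. odd d \<and> d dvd n}"
  define f where "f d = 2 * n div d" for d
  have rep_iff: "(\<exists>a. ap_sum k t a = int n) \<longleftrightarrow> k \<in> A \<union> f ` A" for k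
    unfolding ap_sum_length_iff[OF assms(1,3)] opposite_parity_factors_iff[OF assms(3)]
    by (simp add: A_def f_def)
  \<comment> \<open>The empty sum is 0 and thus differs from \<open>n\<close>.\<close>
  have pos: "0 < k" if "ap_sum k t a = int n" for k a
    using that assms(3) by (cases k) (auto simp: ap_sum_def)
  have unique: "\<exists>!a. ap_sum k t a = int n" if "k \<in> A \<union> f ` A" for k
  proof -
    obtain a where a: "ap_sum k t a = int n" using \<open>k \<in> A \<union> f ` A\<close> rep_iff by blast
    show ?thesis
    proof (rule ex1I, rule a)
      fix b assume "ap_sum k t b = int n"
      with a show "b = a" using ap_sum_inject[OF pos[OF a], of t b a] by simp
    qed
  qed

  have "finite A"
    by (rule finite_subset[OF _ finite_divisors_nat[OF assms(3)]]) (auto simp: A_def)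
  have f_mult: "d * f d = 2 * n" if "d \<in> A" for d
    using that by (simp add: A_def f_def)
  have inj: "inj_on f A"
  proof (rule inj_onI)
    fix d e assume "d \<in> A" "e \<in> A" "f d = f e"
    then have eq: "d * f d = e * f d" "d * f d = 2 * n"
      using f_mult[of d] f_mult[of e] by simp_all
    then have "f d \<noteq> 0" using assms(3) by (intro notI) simp
    with eq(1) show "d = e" by simp
  qed
  \<comment> \<open>An odd \<open>d\<close> leaves the factor 2 of \<open>d * f d = 2 * n\<close> to
    \<open>f d\<close>. So \<open>f\<close> maps the odd divisors to even lengths, and no length is
    counted twice.\<close>
  have "even (f d)" if "d \<in> A" for d
  proof -
    have "even (d * f d)" using f_mult[OF that] by simp
    then show ?thesis using that by (simp add: A_def)
  qed
  then have disj: "A \<inter> f ` A = {}" by (auto simp: A_def)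

  let ?R = "{(k, a). 0 < k \<and> ap_sum k t a = int n}"
  \<comment> \<open>A representation is determined by its length, so counting representations
    amounts to counting lengths.\<close>
  have "inj_on fst ?R"
  proof (rule inj_onI, clarsimp)
    fix k a b assume "0 < k" "ap_sum k t a = int n" "ap_sum k t b = int n"
    then show "a = b" using ap_sum_inject[of k t a b] by simp
  qed
  moreover have "fst ` ?R = A \<union> f ` A"
  proof (rule set_eqI)
    fix k
    have "k \<in> fst ` ?R \<longleftrightarrow> (\<exists>a. ap_sum k t a = int n)"
      using pos by (auto simp: image_iff)
    then show "k \<in> fst ` ?R \<longleftrightarrow> k \<in> A \<union> f ` A" unfolding rep_iff .
  qed
  ultimately have "Phi t n = card (A \<union> f ` A)"
    unfolding Phi_def using card_image[of fst ?R] by simp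
  also have "\<dots> = 2 * card A"
    using \<open>finite A\<close> disj inj by (simp add: card_Un_disjoint card_image)
  also have "card A = d1 n"
    unfolding d1_def A_def by (rule arg_cong[of _ _ card]) (auto simp: odd_pos)
  finally have "Phi t n = 2 * d1 n" .
  moreover have "(\<exists>!a. ap_sum k t a = int n) \<and> (\<exists>!a. ap_sum (2 * n div k) t a = int n)"
    if "0 < k \<and> odd k \<and> k dvd n" for k
  proof -
    have "k \<in> A" using that by (simp add: A_def)
    then have "k \<in> A \<union> f ` A" "2 * n div k \<in> A \<union> f ` A" by (simp_all add: f_def)
    then show ?thesis using unique by simp
  qed
  ultimately show ?thesis by blast
qed

end
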